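(* Let $\boldsymbol{A}=(\boldsymbol{a}_1,\ldots,\boldsymbol{a}_m)^*\in\mathbb{H}^{m\times d}$, where $\mathbb{H}=\mathbb{R}$ or $\mathbb{C}$. Then the condition number $\beta_{\boldsymbol{A}}$ of $\boldsymbol{A}$ satisfies $$\beta_{\boldsymbol{A}}\geq \beta_0^{\mathbb{H}}:=\begin{cases}\sqrt{\frac{\pi}{\pi-2}}\approx 1.659 & \text{if } \mathbb{H}=\mathbb{R},\\ \sqrt{\frac{4}{4-\pi}}\approx 2.159 & \text{if } \mathbb{H}=\mathbb{C}.\end{cases}$$
   Context: $\boldsymbol{A}=(\boldsymbol{a}_1,\ldots,\boldsymbol{a}_m)^*$ means that the $k$-th row of $\boldsymbol{A}$ is $\boldsymbol{a}_k^*$, with $\boldsymbol{a}_k\in\mathbb{H}^d$. For $\boldsymbol{x},\boldsymbol{y}\in\mathbb{H}^d$ set $\mathrm{dist}(\boldsymbol{x},\boldsymbol{y}):=\min\{\|\boldsymbol{x}-c\boldsymbol{y}\|_2 : c\in\mathbb{H},\ |c|=1\}$. For $\boldsymbol{A}\in\mathbb{H}^{m\times d}$, $|\boldsymbol{A}\boldsymbol{x}|\in\mathbb{R}_+^m$ denotes the vector of entrywise absolute values of $\boldsymbol{A}\boldsymbol{x}$. Define $$L_{\boldsymbol{A}}:=\inf_{\boldsymbol{x},\boldsymbol{y}\in\mathbb{H}^d,\ \mathrm{dist}(\boldsymbol{x},\boldsymbol{y})\neq 0}\frac{\||\boldsymbol{A}\boldsymbol{x}|-|\boldsymbol{A}\boldsymbol{y}|\|_2}{\mathrm{dist}(\boldsymbol{x},\boldsymbol{y})},\qquad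 U_{\boldsymbol{A}}:=\sup_{\boldsymbol{x},\boldsymbol{y}\in\mathbb{H}^d,\ \mathrm{dist}(\boldsymbol{x},\boldsymbol{y})\neq 0}\frac{\||\boldsymbol{A}\boldsymbol{x}|-|\boldsymbol{A}\boldsymbol{y}|\|_2}{\mathrm{dist}(\boldsymbol{x},\boldsymbol{y})}.$$ The condition number is $\beta_{\boldsymbol{A}}:=U_{\boldsymbol{A}}/L_{\boldsymbol{A}}$, with the convention $\beta_{\boldsymbol{A}}=+\infty$ if $L_{\boldsymbol{A}}=0$.
   Formalization: The formal theorem assumes d ≥ 2; for d = 1 and A ≠ 0 the claim as stated fails, since dist(x,y) = ||x|−|y|| and then β_A = 1 < β_0. *)

theory Defs
  imports "HOL-Analysis.Analysis"
begin

text \<open>The scalar type \<open>'a\<close> stands for the field H and is instantiated to \<open>real\<close> or \<open>complex\<close>;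
  \<open>norm\<close> on \<open>'a^'d\<close> is the Euclidean norm.\<close>

definition phase_dist :: "'a::real_normed_field^'d \<Rightarrow> 'a^'d \<Rightarrow> real" where
  "phase_dist x y = (INF c\<in>{c. norm c = 1}. norm (x - c *s y))"

definition abs_vec :: "'a::real_normed_field^'m \<Rightarrow> real^'m" where
  "abs_vec v = (\<chi> k. norm (v $ k))"

text \<open>The bounds are taken in \<open>ereal\<close>, so that infimum and supremum need no boundedness
  side conditions.\<close>

definition lower_lipschitz :: "'a::real_normed_field^'d^'m \<Rightarrow> ereal" where
  "lower_lipschitz A =
    (INF (x, y)\<in>{(x, y). phase_dist x y \<noteq> 0}.
       ereal (norm (abs_vec (A *v x) - abs_vec (A *v y)) / phase_dist x y))"

definition upper_lipschitz :: "'a::real_normed_field^'d^'m \<Rightarrow> ereal" where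
  "upper_lipschitz A =
    (SUP (x, y)\<in>{(x, y). phase_dist x y \<noteq> 0}.
       ereal (norm (abs_vec (A *v x) - abs_vec (A *v y)) / phase_dist x y))"

definition condition_number :: "'a::real_normed_field^'d^'m \<Rightarrow> ereal" where
  "condition_number A =
    (if lower_lipschitz A = 0 then \<infinity> else upper_lipschitz A / lower_lipschitz A)"

text \<open>The infimum in \<open>phase_dist\<close> is the minimum of the usual definition.\<close>

lemma phase_dist_attained:
  fixes x y :: "'a::{real_normed_field, heine_borel}^'d"
  obtains c where "norm c = 1" "phase_dist x y = norm (x - c *s y)"
    "\<And>c'. norm c' = 1 \<Longrightarrow> norm (x - c *s y) \<le> norm (x - c' *s y)"
proof -
  let ?S = "{c::'a. norm c = 1}"
  have S: "?S = sphere 0 1" by auto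
  have cont: "continuous_on ?S (\<lambda>c. norm (x - c *s y))"
    unfolding vector_scalar_mult_def
    by (intro continuous_intros)
  have "compact ?S" "?S \<noteq> {}"
    using S norm_one by (auto simp del: norm_one)
  from continuous_attains_inf[OF this cont] obtain c where
    c: "c \<in> ?S" "\<forall>c'\<in>?S. norm (x - c *s y) \<le> norm (x - c' *s y)" by blast
  have "phase_dist x y = norm (x - c *s y)"
    unfolding phase_dist_def using c by (intro cInf_eq_minimum) auto
  then show thesis using that c by auto
qed

text \<open>In dimension one every nonzero matrix has condition number 1, so lower bounds larger than 1
  are only possible for \<open>CARD('d) \<ge> 2\<close>.\<close>

lemma condition_number_dim_1:
  fixes A :: "'a::real_normed_field^'d^'m"
  assumes "CARD('d) = 1" "A \<noteq> 0"
  shows "condition_number A = 1"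
proof -
  obtain i :: 'd where i: "UNIV = {i}" using assms(1) by (metis card_1_singletonE)
  define a where "a = norm (\<chi> k. norm (A $ k $ i))"
  have nrm: "norm z = norm (z $ i)" for z :: "'a^'d"
    unfolding norm_vec_def i L2_set_def by simp
  have dist: "phase_dist x y = \<bar>norm x - norm y\<bar>" for x y :: "'a^'d"
  proof -
    have lb: "\<bar>norm x - norm y\<bar> \<le> norm (x - c *s y)" if "norm c = 1" for c
      using norm_triangle_ineq3[of "x $ i" "c * y $ i"] that by (simp add: nrm norm_mult)
    have "\<exists>c. norm c = 1 \<and> norm (x - c *s y) = \<bar>norm x - norm y\<bar>"
    proof (cases "x $ i = 0 \<or> y $ i = 0")
      case True
      then show ?thesis by (intro exI[of _ 1]) (auto simp: nrm)
    next
      case False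
      let ?c = "x $ i / y $ i * of_real (norm (y $ i) / norm (x $ i))"
      have "x $ i - ?c * y $ i = x $ i / of_real (norm (x $ i)) * of_real (norm (x $ i) - norm (y $ i))"
        using False by (simp add: field_simps)
      then have "norm (x $ i - ?c * y $ i) = \<bar>norm (x $ i) - norm (y $ i)\<bar>"
        using False by (simp only: norm_mult norm_divide norm_of_real) simp
      moreover have "norm ?c = 1" using False by (simp add: norm_mult norm_divide)
      ultimately show ?thesis by (intro exI[of _ ?c]) (simp add: nrm)
    qed
    then show ?thesis
      unfolding phase_dist_def using lb by (intro cInf_eq_minimum) (auto simp: image_iff)
  qed
  have Av: "(A *v x) $ k = A $ k $ i * x $ i" for x k
    by (simp add: matrix_vector_mult_def i)
  have num: "norm (abs_vec (A *v x) - abs_vec (A *v y)) = a * \<bar>norm x - norm y\<bar>" for x y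
  proof -
    have "abs_vec (A *v x) - abs_vec (A *v y) = (norm x - norm y) *\<^sub>R (\<chi> k. norm (A $ k $ i))"
      by (simp add: vec_eq_iff abs_vec_def Av norm_mult nrm algebra_simps)
    then show ?thesis by (simp add: a_def)
  qed
  have "a \<noteq> 0"
  proof
    assume "a = 0"
    then have "A $ k $ i = 0" for k by (simp add: a_def vec_eq_iff)
    moreover have "j = i" for j using i by auto
    ultimately have "A $ k $ j = 0" for k j by metis
    then show False using assms(2) by (simp add: vec_eq_iff)
  qed
  let ?P = "{(x, y). phase_dist x y \<noteq> 0} :: (('a^'d) \<times> ('a^'d)) set"
  have ne: "?P \<noteq> {}"
    using dist[of "axis i 1" 0] by (force simp: nrm)
  have img: "(\<lambda>(x, y). ereal (norm (abs_vec (A *v x) - abs_vec (A *v y)) / phase_dist x y)) ` ?P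
      = {ereal a}" (is "?f ` _ = _")
  proof -
    have "?f p = ereal a" if "p \<in> ?P" for p
      using that by (auto simp: num dist)
    then have "?f ` ?P = (\<lambda>_. ereal a) ` ?P" by (rule image_cong[OF refl])
    then show ?thesis using ne by (simp only: image_constant_conv if_False)
  qed
  have "lower_lipschitz A = ereal a" "upper_lipschitz A = ereal a"
    unfolding lower_lipschitz_def upper_lipschitz_def img by simp_all
  then show ?thesis using \<open>a \<noteq> 0\<close> by (simp add: condition_number_def one_ereal_def zero_ereal_def)
qed

end

theory Submission
  imports Defs
begin

text \<open>Restrict to two coordinates and let \<open>R\<close> be the sum of the squared lengths of the restricted
  rows. Every orthonormal pair \<open>x, y\<close> in this plane has phase distance \<open>sqrt 2\<close> and
  \<open>\<parallel>A x\<parallel>\<^sup>2 + \<parallel>A y\<parallel>\<^sup>2 = R\<close>, so \<open>U\<^sup>2 \<ge> R / 2\<close> and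
  \<open>2 L\<^sup>2 \<le> R - 2 \<Sum>\<^sub>k |a\<^sub>k x| |a\<^sub>k y|\<close>. Averaging the last sum over all orthonormal pairs gives
  \<open>R / \<pi>\<close> in the real and \<open>\<pi> R / 8\<close> in the complex case. In the complex case the pairs are
  parametrised by antipodal points of the Bloch sphere, and
  \<open>|a x| |a y| = |a|\<^sup>2 / 2 * sqrt (1 - w\<^sup>2)\<close>, where \<open>w\<close> is the inner product of the Bloch vectors
  of \<open>a\<close> and \<open>x\<close>.\<close>

subsection \<open>Rotation-invariant averages on the 2-sphere\<close>

text \<open>The inner product of the unit vectors of the 2-sphere with polar angles \<open>\<alpha>\<close>, \<open>\<theta>\<close> and azimuths
  \<open>\<psi>\<close>, \<open>\<phi>\<close>.\<close>

definition zonal :: "real \<Rightarrow> real \<Rightarrow> real \<times> real \<Rightarrow> real" where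
  "zonal \<alpha> \<psi> = (\<lambda>(\<theta>, \<phi>). cos \<alpha> * cos \<theta> + sin \<alpha> * sin \<theta> * cos (\<phi> - \<psi>))"

lemma continuous_on_zonal [continuous_intros]: "continuous_on S (zonal \<alpha> \<psi>)"
  unfolding zonal_def case_prod_beta by (intro continuous_intros)

lemma cauchy_schwarz_2: "\<bar>(a::real) * c + b * d\<bar> \<le> sqrt (a\<^sup>2 + b\<^sup>2) * sqrt (c\<^sup>2 + d\<^sup>2)"
proof -
  have "(a * c + b * d)\<^sup>2 \<le> (a\<^sup>2 + b\<^sup>2) * (c\<^sup>2 + d\<^sup>2)"
    using zero_le_power2[of "a * d - b * c"] by (simp add: power2_eq_square algebra_simps)
  then show ?thesis by (metis real_sqrt_abs real_sqrt_le_mono real_sqrt_mult)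
qed

text \<open>Planar Cauchy-Schwarz for \<open>(cos \<alpha>, sin \<alpha>)\<close> and a second
  vector that has absorbed the factor \<open>cos (\<phi> - \<psi>)\<close> and so has length at most
  1.\<close>

lemma zonal_bounds: "zonal \<alpha> \<psi> p \<in> {-1..1}"
proof -
  obtain \<theta> \<phi> where p: "p = (\<theta>, \<phi>)" by (cases p)
  have "\<bar>zonal \<alpha> \<psi> p\<bar> \<le> sqrt ((cos \<alpha>)\<^sup>2 + (sin \<alpha>)\<^sup>2) * sqrt ((cos \<theta>)\<^sup>2 + (sin \<theta> * cos (\<phi> - \<psi>))\<^sup>2)"
    using cauchy_schwarz_2[of "cos \<alpha>" "cos \<theta>" "sin \<alpha>" "sin \<theta> * cos (\<phi> - \<psi>)"]
    by (simp add: p zonal_def mult.assoc)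
  also have "\<dots> \<le> 1"
  proof -
    have "(sin \<theta> * cos (\<phi> - \<psi>))\<^sup>2 \<le> (sin \<theta>)\<^sup>2"
      using mult_left_mono[OF power_le_one[of "\<bar>cos (\<phi> - \<psi>)\<bar>" 2], of "(sin \<theta>)\<^sup>2"]
      by (simp add: power_mult_distrib)
    then have "(cos \<theta>)\<^sup>2 + (sin \<theta> * cos (\<phi> - \<psi>))\<^sup>2 \<le> 1"
      using sin_cos_squared_add2[of \<theta>] by linarith
    then show ?thesis by simp
  qed
  finally show ?thesis by (simp add: abs_le_iff)
qed

text \<open>Averages over the 2-sphere are rotation invariant because the \<open>\<alpha>\<close>-derivative of the
  integrand is the divergence
  \<open>\<partial>\<^sub>\<theta> (- cos (\<phi> - \<psi>) sin \<theta> f w) + \<partial>\<^sub>\<phi> (cos \<theta> sin (\<phi> - \<psi>) f w)\<close>, where \<open>w\<close> is the zonal variable.\<close>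

lemma zonal_integral_invariant_smooth:
  fixes f f' :: "real \<Rightarrow> real"
  assumes f: "\<And>x. (f has_real_derivative f' x) (at x)" and f': "continuous_on UNIV f'"
  shows "integral (cbox (0, 0) (pi, 2 * pi)) (\<lambda>p. f (zonal \<alpha> \<psi> p) * sin (fst p)) =
         integral (cbox (0, 0) (pi, 2 * pi)) (\<lambda>p. f (cos (fst p)) * sin (fst p))"
proof -
  let ?D = "cbox (0, 0) (pi, 2 * pi) :: (real \<times> real) set"
  \<comment> \<open>The unnormalised average as a function of the polar angle; it is constant
    because its derivative vanishes. The function \<open>w\<alpha>\<close> below is the
    \<open>\<alpha>\<close>-derivative of \<open>zonal\<close>.\<close>
  define J where "J \<alpha> = integral ?D (\<lambda>p. f (zonal \<alpha> \<psi> p) * sin (fst p))" for \<alpha>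
  define w\<alpha> where "w\<alpha> \<alpha> p = - sin \<alpha> * cos (fst p) + cos \<alpha> * sin (fst p) * cos (snd p - \<psi>)" for \<alpha> and p :: "real \<times> real"
  have contf: "continuous_on S f" for S
    using f by (meson DERIV_isCont continuous_at_imp_continuous_on)
  note [continuous_intros] =
    continuous_on_compose2[OF f' _ subset_UNIV] continuous_on_compose2[OF contf _ subset_UNIV]
  have dJ: "(J has_real_derivative 0) (at \<alpha>)" for \<alpha>
  proof -
    let ?w = "zonal \<alpha> \<psi>"
    \<comment> \<open>\<open>P\<close> and \<open>Q\<close> are the two summands of the divergence,
      expanded by the product rule: \<open>P\<close> is the \<open>\<theta>\<close>-derivative and
      \<open>Q\<close> the \<open>\<phi>\<close>-derivative.\<close>
    define P where "P p = - cos (snd p - \<psi>) * (cos (fst p) * f (?w p) + sin (fst p) * f' (?w p) *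
      (- cos \<alpha> * sin (fst p) + sin \<alpha> * cos (fst p) * cos (snd p - \<psi>)))" for p
    define Q where "Q p = cos (fst p) * (cos (snd p - \<psi>) * f (?w p) + sin (snd p - \<psi>) * f' (?w p) *
      (- sin \<alpha> * sin (fst p) * sin (snd p - \<psi>)))" for p
    have contP: "continuous_on S P" for S unfolding P_def by (intro continuous_intros)
    have contQ: "continuous_on S Q" for S unfolding Q_def by (intro continuous_intros)
    have "(J has_real_derivative integral ?D (\<lambda>p. f' (zonal \<alpha> \<psi> p) * w\<alpha> \<alpha> p * sin (fst p))) (at \<alpha> within UNIV)"
      unfolding J_def
    proof (rule leibniz_rule_field_derivative)
      show "((\<lambda>\<alpha>. f (zonal \<alpha> \<psi> p) * sin (fst p)) has_field_derivative
             f' (zonal \<alpha> \<psi> p) * w\<alpha> \<alpha> p * sin (fst p)) (at \<alpha> within UNIV)" for \<alpha> and p :: "real \<times> real"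
        unfolding zonal_def w\<alpha>_def case_prod_beta
        by (rule derivative_eq_intros DERIV_chain2[OF f] refl | simp)+
      show "(\<lambda>p. f (zonal \<alpha> \<psi> p) * sin (fst p)) integrable_on ?D" for \<alpha>
        by (intro integrable_continuous continuous_intros)
      show "continuous_on (UNIV \<times> ?D) (\<lambda>(\<alpha>, p). f' (zonal \<alpha> \<psi> p) * w\<alpha> \<alpha> p * sin (fst p))"
        unfolding zonal_def w\<alpha>_def case_prod_beta by (intro continuous_intros)
    qed auto
    \<comment> \<open>The terms with \<open>f\<close> cancel between \<open>P\<close> and
      \<open>Q\<close>; those with \<open>f'\<close> combine because the squared cosine and sine of
      the azimuth difference add up to 1.\<close>
    also have "(\<lambda>p. f' (zonal \<alpha> \<psi> p) * w\<alpha> \<alpha> p * sin (fst p)) = (\<lambda>p. P p + Q p)"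
    proof
      fix p :: "real \<times> real"
      have s: "cos (snd p - \<psi>) ^ 2 = 1 - sin (snd p - \<psi>) ^ 2" by (rule cos_squared_eq)
      show "f' (zonal \<alpha> \<psi> p) * w\<alpha> \<alpha> p * sin (fst p) = P p + Q p"
        unfolding P_def Q_def w\<alpha>_def using s by algebra
    qed
    also have "integral ?D (\<lambda>p. P p + Q p) = integral ?D P + integral ?D Q"
      by (intro integral_add integrable_continuous contP contQ)
    \<comment> \<open>Integrating over \<open>\<theta>\<close> first leaves boundary terms with the
      factors \<open>sin pi\<close> and \<open>sin 0\<close>, both zero.\<close>
    also have "integral ?D P = 0"
    proof -
      have "((\<lambda>\<theta>. P (\<theta>, \<phi>)) has_integral
             (- cos (\<phi> - \<psi>) * sin pi * f (?w (pi, \<phi>))) - (- cos (\<phi> - \<psi>) * sin 0 * f (?w (0, \<phi>)))) {0..pi}" for \<phi>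
      proof (rule fundamental_theorem_of_calculus)
        fix \<theta> :: real
        show "((\<lambda>\<theta>. - cos (\<phi> - \<psi>) * sin \<theta> * f (?w (\<theta>, \<phi>))) has_vector_derivative P (\<theta>, \<phi>)) (at \<theta> within {0..pi})"
          unfolding has_real_derivative_iff_has_vector_derivative[symmetric] P_def zonal_def prod.case
          by (rule derivative_eq_intros DERIV_chain2[OF f] refl | simp add: algebra_simps)+
      qed simp
      then have "integral (cbox 0 pi) (\<lambda>\<theta>. P (\<theta>, \<phi>)) = 0" for \<phi>
        by (simp add: integral_unique)
      moreover have "integral ?D P = integral (cbox 0 (2*pi)) (\<lambda>\<phi>. integral (cbox 0 pi) (\<lambda>\<theta>. P (\<theta>, \<phi>)))"
        using integral_prod_continuous[OF contP] integral_swap_continuous[of 0 0 pi "2*pi" "\<lambda>\<theta> \<phi>. P (\<theta>, \<phi>)"] contP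
        by (simp add: case_prod_beta)
      ultimately show ?thesis by simp
    qed
    \<comment> \<open>Integrating over \<open>\<phi>\<close> first leaves boundary terms that cancel
      by \<open>2 * pi\<close>-periodicity.\<close>
    also have "integral ?D Q = 0"
    proof -
      have "((\<lambda>\<phi>. Q (\<theta>, \<phi>)) has_integral
             (cos \<theta> * sin (2*pi - \<psi>) * f (?w (\<theta>, 2*pi))) - (cos \<theta> * sin (0 - \<psi>) * f (?w (\<theta>, 0)))) {0..2*pi}" for \<theta>
      proof (rule fundamental_theorem_of_calculus)
        fix \<phi> :: real
        show "((\<lambda>\<phi>. cos \<theta> * sin (\<phi> - \<psi>) * f (?w (\<theta>, \<phi>))) has_vector_derivative Q (\<theta>, \<phi>)) (at \<phi> within {0..2*pi})"
          unfolding has_real_derivative_iff_has_vector_derivative[symmetric] Q_def zonal_def prod.case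
          by (rule derivative_eq_intros DERIV_chain2[OF f] refl | simp add: algebra_simps)+
      qed simp
      then have "integral (cbox 0 (2*pi)) (\<lambda>\<phi>. Q (\<theta>, \<phi>)) = 0" for \<theta>
        by (simp add: integral_unique zonal_def sin_diff cos_diff)
      then show ?thesis using integral_prod_continuous[OF contQ] by simp
    qed
    finally show ?thesis by simp
  qed
  \<comment> \<open>At angle 0 the zonal variable is \<open>cos (fst p)\<close>, so
    \<open>J 0\<close> is the right-hand side.\<close>
  then have "J \<alpha> = J 0"
    by (metis DERIV_isconst_all)
  then show ?thesis
    by (simp add: J_def zonal_def case_prod_beta)
qed

text \<open>Uniform polynomial approximation on \<open>{-1..1}\<close>, where the zonal variable
  takes its values, extends the smooth case. This covers \<open>sqrt (1 - u\<^sup>2)\<close>, which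
  is not differentiable at the endpoints.\<close>

lemma zonal_integral_invariant:
  fixes g :: "real \<Rightarrow> real"
  assumes g: "continuous_on {-1..1} g"
  shows "integral (cbox (0, 0) (pi, 2 * pi)) (\<lambda>p. g (zonal \<alpha> \<psi> p) * sin (fst p)) =
         integral (cbox (0, 0) (pi, 2 * pi)) (\<lambda>p. g (cos (fst p)) * sin (fst p))"
    (is "?I (zonal \<alpha> \<psi>) = ?I (\<lambda>p. cos (fst p))")
proof -
  let ?D = "cbox (0, 0) (pi, 2 * pi) :: (real \<times> real) set"
  \<comment> \<open>The factor 2 counts one approximation error for each of the two integrals; the
    weight \<open>sin (fst p)\<close> is at most 1 in absolute value.\<close>
  have close: "\<bar>?I (zonal \<alpha> \<psi>) - ?I (\<lambda>p. cos (fst p))\<bar> \<le> e * (2 * measure lborel ?D)" if "e > 0" for e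
  proof -
    obtain f where f: "real_polynomial_function f" and fg: "\<And>x. x \<in> {-1..1} \<Longrightarrow> \<bar>g x - f x\<bar> < e"
      using Stone_Weierstrass_real_polynomial_function[OF compact_Icc g \<open>e > 0\<close>] by blast
    obtain f' where f': "real_polynomial_function f'" "\<And>x. (f has_real_derivative f' x) (at x)"
      using has_real_derivative_polynomial_function[OF f] by blast
    have cf: "continuous_on S f" "continuous_on S f'" for S :: "real set"
      using f f' by (auto intro: continuous_on_polymonial_function simp: real_polynomial_function_eq)
    have eq: "integral ?D (\<lambda>p. f (zonal \<alpha> \<psi> p) * sin (fst p)) =
       integral ?D (\<lambda>p. f (cos (fst p)) * sin (fst p))"
      by (rule zonal_integral_invariant_smooth[OF f'(2) cf(2)])
    have approx: "\<bar>?I w - integral ?D (\<lambda>p. f (w p) * sin (fst p))\<bar> \<le> e * measure lborel ?D"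
      if w: "continuous_on ?D w" "\<And>p. w p \<in> {-1..1}" for w
    proof -
      have int: "(\<lambda>p. g (w p) * sin (fst p)) integrable_on ?D" "(\<lambda>p. f (w p) * sin (fst p)) integrable_on ?D"
        using w by (auto intro!: integrable_continuous continuous_intros continuous_on_compose2[OF g] continuous_on_compose2[OF cf(1)])
      have "norm (integral ?D (\<lambda>p. g (w p) * sin (fst p) - f (w p) * sin (fst p))) \<le> e * measure lborel ?D"
      proof (rule has_integral_bound[OF _ integrable_integral])
        show "norm (g (w p) * sin (fst p) - f (w p) * sin (fst p)) \<le> e" for p
        proof -
          have "\<bar>g (w p) - f (w p)\<bar> * \<bar>sin (fst p)\<bar> \<le> e * 1"
            using fg[OF w(2), of p] \<open>e > 0\<close> by (intro mult_mono) simp_all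
          then show ?thesis by (simp add: left_diff_distrib[symmetric] abs_mult)
        qed
      qed (use \<open>e > 0\<close> int in \<open>auto intro!: integrable_diff\<close>)
      then show ?thesis using int by (simp add: integral_diff)
    qed
    have "continuous_on ?D (\<lambda>p. cos (fst p))" by (intro continuous_intros)
    from approx[OF continuous_on_zonal zonal_bounds, of \<alpha> \<psi>] approx[OF this]
    show ?thesis unfolding eq by simp
  qed
  have "\<bar>?I (zonal \<alpha> \<psi>) - ?I (\<lambda>p. cos (fst p))\<bar> \<le> 0"
  proof (rule field_le_epsilon)
    fix e :: real assume "e > 0"
    define M where "M = 2 * measure lborel ?D"
    have "M \<ge> 0" by (simp add: M_def)
    then have M: "e / (M + 1) * M \<le> e" using \<open>e > 0\<close> by (simp add: field_simps)
    have "e / (M + 1) > 0" using \<open>e > 0\<close> \<open>M \<ge> 0\<close> by simp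
    from order_trans[OF close[OF this, folded M_def] M]
    show "\<bar>?I (zonal \<alpha> \<psi>) - ?I (\<lambda>p. cos (fst p))\<bar> \<le> 0 + e"
      by simp
  qed
  then show ?thesis by simp
qed

section \<open>Explicit integrals of sines\<close>

text \<open>The area of the unit sphere, which normalises the averages.\<close>

lemma integral_sin_box: "integral (cbox (0, 0) (pi, 2 * pi)) (\<lambda>p. sin (fst p)) = 4 * pi"
proof -
  have "(sin has_integral (- cos pi) - (- cos 0)) {0..pi}"
    by (rule fundamental_theorem_of_calculus)
       (auto simp: has_real_derivative_iff_has_vector_derivative[symmetric] intro!: derivative_eq_intros)
  then have "integral {0..pi} sin = 2" by (simp add: integral_unique)
  then show ?thesis
    by (subst integral_prod_continuous) (auto intro!: continuous_intros)
qed

lemma integral_sin_squared_box: "integral (cbox (0, 0) (pi, 2 * pi)) (\<lambda>p. sin (fst p) * sin (fst p)) = pi\<^sup>2"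
proof -
  have "((\<lambda>x. sin x * sin x) has_integral (pi - sin pi * cos pi) / 2 - (0 - sin 0 * cos 0) / 2) {0..pi}"
  proof (rule fundamental_theorem_of_calculus)
    fix x :: real
    have "((\<lambda>x. (x - sin x * cos x) / 2) has_real_derivative (1 - (cos x * cos x - sin x * sin x)) / 2) (at x within {0..pi})"
      by (rule derivative_eq_intros refl | simp)+
    moreover have "(1 - (cos x * cos x - sin x * sin x)) / 2 = sin x * sin x"
      using sin_cos_squared_add3[of x] by (simp add: field_simps)
    ultimately show "((\<lambda>x. (x - sin x * cos x) / 2) has_vector_derivative sin x * sin x) (at x within {0..pi})"
      by (simp add: has_real_derivative_iff_has_vector_derivative)
  qed simp
  then have "integral (cbox 0 pi) (\<lambda>x. sin x * sin x) = pi / 2" by (simp add: integral_unique)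
  moreover have "integral (cbox (0, 0) (pi, 2 * pi)) (\<lambda>p. sin (fst p) * sin (fst p)) =
      integral (cbox 0 pi) (\<lambda>x. integral (cbox 0 (2 * pi)) (\<lambda>y. sin x * sin x))"
    by (subst integral_prod_continuous) (auto intro!: continuous_intros)
  moreover have "\<dots> = integral (cbox 0 pi) (\<lambda>x. 2 * pi * (sin x * sin x))"
    by (intro integral_cong) simp
  ultimately show ?thesis
    by (simp only: integral_mult_right) (simp add: power2_eq_square)
qed

text \<open>By invariance the axis may be taken as the pole, where the root becomes
  \<open>sin (fst p)\<close>. Divided by the area \<open>4 * pi\<close>, this is the mean
  \<open>pi / 4\<close>.\<close>

lemma integral_sqrt_zonal:
  "integral (cbox (0, 0) (pi, 2 * pi)) (\<lambda>p. sqrt (1 - (zonal \<alpha> \<psi> p)\<^sup>2) * sin (fst p)) = pi\<^sup>2"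
proof -
  have "integral (cbox (0, 0) (pi, 2 * pi)) (\<lambda>p. sqrt (1 - (zonal \<alpha> \<psi> p)\<^sup>2) * sin (fst p)) =
        integral (cbox (0, 0) (pi, 2 * pi)) (\<lambda>p. sqrt (1 - (cos (fst p))\<^sup>2) * sin (fst p))"
    by (rule zonal_integral_invariant[of "\<lambda>u. sqrt (1 - u\<^sup>2)"]) (intro continuous_intros)
  also have "\<dots> = integral (cbox (0, 0) (pi, 2 * pi)) (\<lambda>p. sin (fst p) * sin (fst p))"
    by (rule integral_cong) (auto simp: sin_squared_eq[symmetric] cbox_Pair_eq sin_ge_zero)
  finally show ?thesis by (simp add: integral_sin_squared_box)
qed

text \<open>The absolute sine has period \<open>pi\<close>, so a shift does not change its integral
  over a full period.\<close>

lemma integral_abs_sin_shift: "((\<lambda>t. \<bar>sin (t - s)\<bar>) has_integral 2) {0..pi}"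
proof -
  \<comment> \<open>Reducing the shift modulo \<open>pi\<close> to \<open>r\<close> in
    \<open>{0..pi}\<close> leaves a single possible sign change of \<open>sin (t - r)\<close> inside
    the interval, at \<open>t = r\<close>, where the integral is split.\<close>
  define k where "k = \<lfloor>s / pi\<rfloor>"
  define r where "r = s - of_int k * pi"
  have "of_int k \<le> s / pi" "s / pi < of_int k + 1" unfolding k_def by linarith+
  then have r: "0 \<le> r" "r \<le> pi"
    by (auto simp: r_def field_simps intro: less_imp_le)
  have "\<bar>sin (t - s)\<bar> = \<bar>sin (t - r)\<bar>" for t
  proof -
    have "sin (t - s) = sin ((t - r) - of_int k * pi)" by (simp add: r_def)
    also have "\<bar>\<dots>\<bar> = \<bar>sin (t - r)\<bar> * \<bar>cos (pi * of_int k)\<bar>" by (simp add: sin_diff abs_mult mult.commute)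
    also have "\<bar>cos (pi * of_int k)\<bar> = 1" by simp
    finally show ?thesis by simp
  qed
  moreover have "((\<lambda>t. \<bar>sin (t - r)\<bar>) has_integral 2) {0..pi}"
  proof -
    have "((\<lambda>t. - sin (t - r)) has_integral cos (r - r) - cos (0 - r)) {0..r}"
      by (rule fundamental_theorem_of_calculus[OF r(1)])
       (auto simp: has_real_derivative_iff_has_vector_derivative[symmetric] intro!: derivative_eq_intros)
    moreover have "\<bar>sin (t - r)\<bar> = - sin (t - r)" if "0 \<le> t" "t \<le> r" for t
      using sin_ge_zero[of "r - t"] sin_minus[of "r - t"] that r by simp
    ultimately have 1: "((\<lambda>t. \<bar>sin (t - r)\<bar>) has_integral cos (r - r) - cos (0 - r)) {0..r}"
      by (subst has_integral_cong) auto
    have "((\<lambda>t. sin (t - r)) has_integral - cos (pi - r) - (- cos (r - r))) {r..pi}"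
      by (rule fundamental_theorem_of_calculus[OF r(2)])
       (auto simp: has_real_derivative_iff_has_vector_derivative[symmetric] intro!: derivative_eq_intros)
    moreover have "\<bar>sin (t - r)\<bar> = sin (t - r)" if "r \<le> t" "t \<le> pi" for t
      using sin_ge_zero[of "t - r"] that r by simp
    ultimately have 2: "((\<lambda>t. \<bar>sin (t - r)\<bar>) has_integral - cos (pi - r) - (- cos (r - r))) {r..pi}"
      by (subst has_integral_cong) auto
    show ?thesis using has_integral_combine[OF r 1 2] by simp
  qed
  ultimately show ?thesis by simp
qed

subsection \<open>Orthonormal pairs and the condition number\<close>

text \<open>Serves orthonormal pairs and the case \<open>y = 0\<close>, where the norm does not
  depend on the phase \<open>c\<close>.\<close>

lemma phase_dist_eqI:
  fixes x y :: "'a::real_normed_field^'d"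
  assumes "\<And>c. norm c = 1 \<Longrightarrow> norm (x - c *s y) = D"
  shows "phase_dist x y = D"
proof -
  have "{c::'a. norm c = 1} \<noteq> {}" using norm_one by blast
  then show ?thesis unfolding phase_dist_def using assms by (intro cInf_eq_minimum) (auto simp: image_iff)
qed

lemma phase_dist_nonneg: "phase_dist x (y :: 'a::real_normed_field^'d) \<ge> 0"
proof -
  have "{c::'a. norm c = 1} \<noteq> {}" using norm_one by blast
  then show ?thesis unfolding phase_dist_def by (intro cINF_greatest) auto
qed

lemma norm_vec_squared: "(norm (v :: 'a::real_normed_vector^'d))\<^sup>2 = (\<Sum>k\<in>UNIV. (norm (v $ k))\<^sup>2)"
  by (simp add: norm_vec_def L2_set_def sum_nonneg)

lemma norm_abs_vec: "norm (abs_vec v) = norm v"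
  by (simp add: abs_vec_def norm_vec_def L2_set_def)

lemma norm_abs_vec_diff_squared:
  "(norm (abs_vec u - abs_vec v))\<^sup>2 =
   (\<Sum>k\<in>UNIV. (norm (u $ k))\<^sup>2 + (norm (v $ k))\<^sup>2 - 2 * (norm (u $ k) * norm (v $ k)))"
  by (simp add: norm_vec_squared abs_vec_def power2_diff mult.assoc)

lemma lower_lipschitz_le:
  assumes "phase_dist x y \<noteq> 0"
  shows "lower_lipschitz A \<le> ereal (norm (abs_vec (A *v x) - abs_vec (A *v y)) / phase_dist x y)"
  unfolding lower_lipschitz_def using assms by (intro INF_lower2[of "(x, y)"]) auto

lemma lower_lipschitz_nonneg: "lower_lipschitz A \<ge> 0"
  unfolding lower_lipschitz_def by (intro INF_greatest) (auto intro!: divide_nonneg_nonneg phase_dist_nonneg)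

text \<open>Comparing \<open>x\<close> with 0 turns the quotient into
  \<open>norm (A *v x)\<close>.\<close>

lemma upper_lipschitz_ge:
  fixes A :: "'a::real_normed_field^'d^'m"
  assumes "norm x = 1"
  shows "ereal (norm (A *v x)) \<le> upper_lipschitz A"
proof -
  have "phase_dist x 0 = 1" using assms by (intro phase_dist_eqI) simp
  moreover have "abs_vec (0 :: 'a^'m) = 0" by (simp add: abs_vec_def vec_eq_iff)
  ultimately show ?thesis
    unfolding upper_lipschitz_def by (intro SUP_upper2[of "(x, 0)"]) (auto simp: norm_abs_vec)
qed

text \<open>The argument common to both fields. Assumption \<open>low\<close> stands for the
  averaging over orthonormal pairs, and \<open>\<kappa>\<close> for the averaged loss factor. One of
  \<open>x\<close>, \<open>y\<close> has an image of squared norm at least \<open>R / 2\<close>, so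
  \<open>2 * l\<^sup>2 \<le> \<kappa> * R\<close> bounds the ratio of the Lipschitz
  constants.\<close>

lemma condition_number_ge:
  fixes A :: "'a::real_normed_field^'d^'m"
  assumes "\<kappa> > 0" and x: "norm x = 1" and y: "norm y = 1" and xy: "phase_dist x y = sqrt 2"
    and R: "(norm (A *v x))\<^sup>2 + (norm (A *v y))\<^sup>2 = R"
    and low: "\<And>l. (\<And>x y. phase_dist x y = sqrt 2 \<Longrightarrow>
        2 * l\<^sup>2 \<le> (norm (abs_vec (A *v x) - abs_vec (A *v y)))\<^sup>2) \<Longrightarrow> 2 * l\<^sup>2 \<le> \<kappa> * R"
  shows "ereal (sqrt (1 / \<kappa>)) \<le> condition_number A"
proof (cases "lower_lipschitz A = 0")
  case True
  then show ?thesis by (simp add: condition_number_def)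
next
  case False
  \<comment> \<open>The given pair has nonzero phase distance, so the infimum is bounded by a real
    quotient.\<close>
  have "lower_lipschitz A \<noteq> \<infinity>" using lower_lipschitz_le[of x y A] xy by auto
  then obtain l where l: "lower_lipschitz A = ereal l" "l > 0"
    using False lower_lipschitz_nonneg[of A] by (cases "lower_lipschitz A") (auto simp: zero_ereal_def)
  have "2 * l\<^sup>2 \<le> \<kappa> * R"
  proof (rule low)
    fix x y :: "'a^'d"
    assume "phase_dist x y = sqrt 2"
    then have "l * sqrt 2 \<le> norm (abs_vec (A *v x) - abs_vec (A *v y))"
      using lower_lipschitz_le[of x y A] l by (simp add: field_simps)
    then have "(l * sqrt 2)\<^sup>2 \<le> (norm (abs_vec (A *v x) - abs_vec (A *v y)))\<^sup>2"
      using l by (intro power_mono) auto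
    then show "2 * l\<^sup>2 \<le> (norm (abs_vec (A *v x) - abs_vec (A *v y)))\<^sup>2"
      by (simp add: power_mult_distrib)
  qed
  define u where "u = max (norm (A *v x)) (norm (A *v y))"
  have "u \<ge> 0" by (simp add: u_def le_max_iff_disj)
  have "(norm (A *v x))\<^sup>2 \<le> u\<^sup>2" "(norm (A *v y))\<^sup>2 \<le> u\<^sup>2"
    by (auto simp: u_def intro!: power_mono)
  then have "\<kappa> * R \<le> \<kappa> * (2 * u\<^sup>2)"
    using R \<open>\<kappa> > 0\<close> by (intro mult_left_mono) auto
  then have "l\<^sup>2 \<le> \<kappa> * u\<^sup>2"
    using \<open>2 * l\<^sup>2 \<le> \<kappa> * R\<close> by linarith
  then have "l\<^sup>2 / \<kappa> \<le> u\<^sup>2"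
    using \<open>\<kappa> > 0\<close> by (simp add: pos_divide_le_eq mult.commute[of _ \<kappa>])
  then have "sqrt (l\<^sup>2 / \<kappa>) \<le> sqrt (u\<^sup>2)" by (rule real_sqrt_le_mono)
  then have "sqrt (1 / \<kappa>) \<le> u / l"
    using l \<open>u \<ge> 0\<close> \<open>\<kappa> > 0\<close> by (simp add: real_sqrt_divide field_simps)
  also have "ereal (u / l) \<le> upper_lipschitz A / lower_lipschitz A"
  proof -
    have "ereal u \<le> upper_lipschitz A"
      using upper_lipschitz_ge[OF x, of A] upper_lipschitz_ge[OF y, of A] by (simp add: u_def max_def)
    then have "ereal u / ereal l \<le> upper_lipschitz A / ereal l"
      using l by (intro ereal_divide_right_mono) auto
    then show ?thesis using l by simp
  qed
  finally show ?thesis using False by (simp add: condition_number_def)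
qed

section \<open>Vectors supported on two coordinates\<close>

definition pair_vec :: "'d::finite \<Rightarrow> 'd \<Rightarrow> 'a \<Rightarrow> 'a \<Rightarrow> 'a::real_normed_field^'d" where
  "pair_vec i j p q = (\<chi> l. if l = i then p else if l = j then q else 0)"

lemma sum_pair:
  fixes f :: "'d::finite \<Rightarrow> 'b::comm_monoid_add"
  assumes "i \<noteq> j" "\<And>l. l \<noteq> i \<Longrightarrow> l \<noteq> j \<Longrightarrow> f l = 0"
  shows "sum f UNIV = f i + f j"
proof -
  have "sum f UNIV = sum f {i, j}" using assms by (intro sum.mono_neutral_right) auto
  then show ?thesis using assms by simp
qed

lemma norm_pair_vec: "i \<noteq> j \<Longrightarrow> norm (pair_vec i j p q) = sqrt ((norm p)\<^sup>2 + (norm q)\<^sup>2)"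
  unfolding norm_vec_def L2_set_def pair_vec_def by (subst sum_pair[of i j]) auto

lemma matrix_mult_pair_vec:
  "i \<noteq> j \<Longrightarrow> (A *v pair_vec i j p q) $ k = A $ k $ i * p + A $ k $ j * q"
  unfolding matrix_vector_mult_def pair_vec_def by (simp add: sum_pair[of i j])

lemma pair_vec_diff: "pair_vec i j p q - c *s pair_vec i j p' q' = pair_vec i j (p - c * p') (q - c * q')"
  by (simp add: pair_vec_def vec_eq_iff)

section \<open>The real case\<close>

lemma condition_number_real:
  fixes A :: "real^'d^'m" and i j :: 'd
  assumes ij: "i \<noteq> j"
  shows "condition_number A \<ge> ereal (sqrt (pi / (pi - 2)))"
proof -
  \<comment> \<open>Half angles make the products below sines of \<open>t\<close> itself. Advancing
    \<open>t\<close> by \<open>pi\<close> sends the pair \<open>(X, Y)\<close> to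
    \<open>(Y, -X)\<close>, so \<open>{0..pi}\<close> covers all frames up to order and
    signs.\<close>
  define X :: "real \<Rightarrow> real^'d" where "X t = pair_vec i j (cos (t/2)) (sin (t/2))" for t
  define Y :: "real \<Rightarrow> real^'d" where "Y t = pair_vec i j (- sin (t/2)) (cos (t/2))" for t
  define r where "r k = (A $ k $ i)\<^sup>2 + (A $ k $ j)\<^sup>2" for k
  have unit: "norm (X t) = 1" "norm (Y t) = 1" for t
    using ij by (simp_all add: X_def Y_def norm_pair_vec)
  have dist: "phase_dist (X t) (Y t) = sqrt 2" for t
  proof (rule phase_dist_eqI)
    fix c :: real assume "norm c = 1"
    then have "c\<^sup>2 = 1" by (simp add: abs_square_eq_1)
    then have "(cos (t/2) - c * - sin (t/2))\<^sup>2 + (sin (t/2) - c * cos (t/2))\<^sup>2 = 2"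
      using sin_cos_squared_add[of "t/2"] by algebra
    then show "norm (X t - c *s Y t) = sqrt 2"
      using ij by (simp add: X_def Y_def pair_vec_diff norm_pair_vec)
  qed
  have AX: "(A *v X t) $ k = A $ k $ i * cos (t/2) + A $ k $ j * sin (t/2)"
    and AY: "(A *v Y t) $ k = A $ k $ j * cos (t/2) - A $ k $ i * sin (t/2)" for t k
    using ij by (simp_all add: X_def Y_def matrix_mult_pair_vec)
  have sq: "((A *v X t) $ k)\<^sup>2 + ((A *v Y t) $ k)\<^sup>2 = r k" for t k
    unfolding AX AY r_def using sin_cos_squared_add[of "t/2"] by algebra
  have "\<exists>s. \<forall>t. \<bar>(A *v X t) $ k\<bar> * \<bar>(A *v Y t) $ k\<bar> = r k / 2 * \<bar>sin (t - s)\<bar>" for k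
  proof -
    \<comment> \<open>In polar coordinates of the restricted row, the two images are
      \<open>\<rho> * cos (t/2 - s)\<close> and \<open>- (\<rho> * sin (t/2 - s))\<close>. The
      double angle formula gives the shift \<open>2 * s\<close>.\<close>
    obtain \<rho> s where rs: "A $ k $ i = \<rho> * cos s" "A $ k $ j = \<rho> * sin s"
      using polar_Ex by blast
    have r: "r k = \<rho>\<^sup>2" unfolding r_def rs using sin_cos_squared_add[of s] by algebra
    have "(A *v X t) $ k * (A *v Y t) $ k = - (r k / 2 * sin (t - 2 * s))" for t
    proof -
      have "(A *v X t) $ k = \<rho> * cos (t/2 - s)" "(A *v Y t) $ k = - (\<rho> * sin (t/2 - s))"
        unfolding AX AY rs by (simp_all add: sin_diff cos_diff algebra_simps)
      moreover have "sin (t - 2 * s) = 2 * sin (t/2 - s) * cos (t/2 - s)"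
        using sin_double[of "t/2 - s"] by (simp add: right_diff_distrib)
      ultimately show ?thesis by (simp add: r power2_eq_square)
    qed
    then show ?thesis
      by (intro exI[of _ "2 * s"]) (simp add: abs_mult[symmetric] r, simp add: abs_mult)
  qed
  then obtain s where s: "\<And>k t. \<bar>(A *v X t) $ k\<bar> * \<bar>(A *v Y t) $ k\<bar> = r k / 2 * \<bar>sin (t - s k)\<bar>"
    by metis
  \<comment> \<open>The mean of the absolute sine over a period is \<open>2 / pi\<close>, hence
    \<open>\<kappa> = 1 - 2 / pi\<close>.\<close>
  have "ereal (sqrt (1 / ((pi - 2) / pi))) \<le> condition_number A"
  proof (rule condition_number_ge[OF _ unit(1) unit(2) dist])
    show "(pi - 2) / pi > 0" using pi_gt3 by simp
    show "(norm (A *v X 0))\<^sup>2 + (norm (A *v Y 0))\<^sup>2 = (\<Sum>k\<in>UNIV. r k)"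
      by (simp add: norm_vec_squared sum.distrib[symmetric] sq)
    fix l
    assume l: "\<And>x y. phase_dist x y = sqrt 2 \<Longrightarrow>
      2 * l\<^sup>2 \<le> (norm (abs_vec (A *v x) - abs_vec (A *v y)))\<^sup>2"
    have le: "2 * l\<^sup>2 \<le> (\<Sum>k\<in>UNIV. r k * (1 - \<bar>sin (t - s k)\<bar>))" for t
      using l[OF dist[of t]] by (simp add: norm_abs_vec_diff_squared sq s algebra_simps)
    have "((\<lambda>t. \<Sum>k\<in>UNIV. r k * (1 - \<bar>sin (t - s k)\<bar>)) has_integral (\<Sum>k\<in>UNIV. r k * (pi - 2))) {0..pi}"
      using has_integral_const_real[of "1::real" 0 pi]
      by (intro has_integral_sum has_integral_mult_right has_integral_diff integral_abs_sin_shift) auto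
    moreover have "((\<lambda>t. 2 * l\<^sup>2) has_integral pi * (2 * l\<^sup>2)) {0..pi}"
      using has_integral_const_real[of "2 * l\<^sup>2" 0 pi] by simp
    ultimately have "pi * (2 * l\<^sup>2) \<le> (\<Sum>k\<in>UNIV. r k * (pi - 2))"
      using le by (meson has_integral_le)
    then show "2 * l\<^sup>2 \<le> (pi - 2) / pi * (\<Sum>k\<in>UNIV. r k)"
      by (simp only: sum_distrib_right[symmetric]) (simp add: field_simps)
  qed
  then show ?thesis by simp
qed

section \<open>The complex case\<close>

text \<open>A squared inner product with a unit vector is affine in the inner product of the Bloch
  vectors. The second formula belongs to the orthogonal vector, the antipodal Bloch point, so
  \<open>zonal\<close> changes sign.\<close>

lemma complex_row_bloch:
  fixes a b :: complex
  obtains \<alpha> \<psi> where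
    "\<And>\<theta> \<phi>. (cmod (a * of_real (cos (\<theta>/2)) + b * (cis \<phi> * of_real (sin (\<theta>/2)))))\<^sup>2 =
       ((cmod a)\<^sup>2 + (cmod b)\<^sup>2) * (1 + zonal \<alpha> \<psi> (\<theta>, \<phi>)) / 2"
    "\<And>\<theta> \<phi>. (cmod (b * of_real (cos (\<theta>/2)) - a * (cis (- \<phi>) * of_real (sin (\<theta>/2)))))\<^sup>2 =
       ((cmod a)\<^sup>2 + (cmod b)\<^sup>2) * (1 - zonal \<alpha> \<psi> (\<theta>, \<phi>)) / 2"
proof -
  obtain \<rho> t where rt: "cmod a = \<rho> * cos t" "cmod b = \<rho> * sin t"
    using polar_Ex by blast
  define \<mu> \<nu> where "\<mu> = Arg a" "\<nu> = Arg b"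
  have ab: "a = (\<rho> * cos t) * cis \<mu>" "b = (\<rho> * sin t) * cis \<nu>"
    using rcis_cmod_Arg[of a] rcis_cmod_Arg[of b] by (simp_all add: rcis_def rt \<mu>_\<nu>_def)
  have trig: "cos \<theta> = (cos (\<theta>/2))\<^sup>2 - (sin (\<theta>/2))\<^sup>2" "sin \<theta> = 2 * sin (\<theta>/2) * cos (\<theta>/2)" for \<theta> :: real
    using cos_double[of "\<theta>/2"] sin_double[of "\<theta>/2"] by simp_all
  \<comment> \<open>The law of cosines for two complex numbers in polar form.\<close>
  have cmod_add: "(cmod (of_real p * cis u + of_real q * cis v))\<^sup>2 = p\<^sup>2 + q\<^sup>2 + 2 * p * q * cos (v - u)" for p q u v
  proof -
    have "(p * cos u + q * cos v)\<^sup>2 + (p * sin u + q * sin v)\<^sup>2 =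
       p\<^sup>2 + q\<^sup>2 + 2 * p * q * (cos v * cos u + sin v * sin u)"
      using sin_cos_squared_add[of u] sin_cos_squared_add[of v] by algebra
    then show ?thesis by (simp add: cmod_power2 cos_diff)
  qed
  have r: "(cmod a)\<^sup>2 + (cmod b)\<^sup>2 = \<rho>\<^sup>2"
    unfolding rt using sin_cos_squared_add[of t] by algebra
  \<comment> \<open>The row acts without conjugation, so these are the Bloch angles of the
    conjugated row: twice the angle \<open>t\<close> of the moduli, and the phase difference
    \<open>\<mu> - \<nu>\<close>.\<close>
  show thesis
  proof (rule that[of "2 * t" "\<mu> - \<nu>"])
    fix \<theta> \<phi> :: real
    let ?w = "zonal (2 * t) (\<mu> - \<nu>) (\<theta>, \<phi>)"
    \<comment> \<open>With these abbreviations both claims become polynomial identities modulo the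
      two relations in \<open>cs\<close>.\<close>
    define c s C S x where "c = cos (\<theta>/2)" "s = sin (\<theta>/2)" "C = cos t" "S = sin t" "x = cos (\<phi> - (\<mu> - \<nu>))"
    note defs = this
    have cs: "c\<^sup>2 + s\<^sup>2 = 1" "C\<^sup>2 + S\<^sup>2 = 1" by (simp_all add: defs)
    have w: "?w = (C\<^sup>2 - S\<^sup>2) * (c\<^sup>2 - s\<^sup>2) + (2 * S * C) * (2 * s * c) * x"
      by (simp only: zonal_def prod.case defs trig[of \<theta>] cos_double sin_double)
    have "a * of_real (cos (\<theta>/2)) + b * (cis \<phi> * of_real (sin (\<theta>/2))) = of_real (\<rho> * C * c) * cis \<mu> + of_real (\<rho> * S * s) * cis (\<nu> + \<phi>)"
      by (simp add: ab defs cis_mult[symmetric])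
    then have "(cmod (a * of_real (cos (\<theta>/2)) + b * (cis \<phi> * of_real (sin (\<theta>/2)))))\<^sup>2 =
       (\<rho> * C * c)\<^sup>2 + (\<rho> * S * s)\<^sup>2 + 2 * (\<rho> * C * c) * (\<rho> * S * s) * x"
      by (simp only: cmod_add) (simp add: defs algebra_simps)
    also have "\<dots> = \<rho>\<^sup>2 * (1 + ?w) / 2"
      unfolding w using cs by algebra
    finally show "(cmod (a * of_real (cos (\<theta>/2)) + b * (cis \<phi> * of_real (sin (\<theta>/2)))))\<^sup>2 = ((cmod a)\<^sup>2 + (cmod b)\<^sup>2) * (1 + ?w) / 2"
      by (simp only: r)
    have "b * of_real (cos (\<theta>/2)) - a * (cis (- \<phi>) * of_real (sin (\<theta>/2))) = of_real (\<rho> * S * c) * cis \<nu> + of_real (- (\<rho> * C * s)) * cis (\<mu> + - \<phi>)"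
      by (simp only: ab defs cis_mult[symmetric]) (simp add: algebra_simps)
    then have "(cmod (b * of_real (cos (\<theta>/2)) - a * (cis (- \<phi>) * of_real (sin (\<theta>/2)))))\<^sup>2 =
       (\<rho> * S * c)\<^sup>2 + (- (\<rho> * C * s))\<^sup>2 + 2 * (\<rho> * S * c) * (- (\<rho> * C * s)) * x"
      using cos_minus[of "\<phi> - (\<mu> - \<nu>)"] by (simp only: cmod_add) (simp add: defs algebra_simps)
    also have "\<dots> = \<rho>\<^sup>2 * (1 - ?w) / 2"
      unfolding w using cs by algebra
    finally show "(cmod (b * of_real (cos (\<theta>/2)) - a * (cis (- \<phi>) * of_real (sin (\<theta>/2)))))\<^sup>2 = ((cmod a)\<^sup>2 + (cmod b)\<^sup>2) * (1 - ?w) / 2"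
      by (simp only: r)
  qed
qed

text \<open>The two vectors are orthonormal for the Hermitian inner product, so by Pythagoras every
  unimodular \<open>c\<close> gives squared distance \<open>1 + 1\<close>.\<close>

lemma phase_dist_unitary_pair:
  fixes p q :: complex
  assumes "i \<noteq> j" "(cmod p)\<^sup>2 + (cmod q)\<^sup>2 = 1"
  shows "phase_dist (pair_vec i j p q) (pair_vec i j (- cnj q) (cnj p)) = sqrt 2"
proof (rule phase_dist_eqI)
  fix c :: complex assume "norm c = 1"
  then have c: "(Re c)\<^sup>2 + (Im c)\<^sup>2 = 1" by (metis cmod_power2 one_power2)
  have "(cmod (p - c * - cnj q))\<^sup>2 + (cmod (q - c * cnj p))\<^sup>2 = 2"
    using c assms(2) unfolding cmod_power2 by simp algebra
  then show "norm (pair_vec i j p q - c *s pair_vec i j (- cnj q) (cnj p)) = sqrt 2"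
    by (simp only: pair_vec_diff norm_pair_vec[OF assms(1)])
qed

lemma condition_number_complex:
  fixes B :: "complex^'d^'m" and i j :: 'd
  assumes ij: "i \<noteq> j"
  shows "condition_number B \<ge> ereal (sqrt (4 / (4 - pi)))"
proof -
  let ?D = "cbox (0, 0) (pi, 2 * pi) :: (real \<times> real) set"
  \<comment> \<open>\<open>X\<close> represents the Bloch point with polar angle
    \<open>\<theta>\<close> and azimuth \<open>\<phi>\<close>; \<open>Y\<close> is an orthogonal
    unit vector, representing the antipode.\<close>
  define X :: "real \<times> real \<Rightarrow> complex^'d" where
    "X = (\<lambda>(\<theta>, \<phi>). pair_vec i j (of_real (cos (\<theta>/2))) (cis \<phi> * of_real (sin (\<theta>/2))))"
  define Y :: "real \<times> real \<Rightarrow> complex^'d" where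
    "Y = (\<lambda>(\<theta>, \<phi>). pair_vec i j (- (cis (- \<phi>) * of_real (sin (\<theta>/2)))) (of_real (cos (\<theta>/2))))"
  define r where "r k = (cmod (B $ k $ i))\<^sup>2 + (cmod (B $ k $ j))\<^sup>2" for k
  have unit: "norm (X p) = 1" "norm (Y p) = 1" for p
    using ij by (cases p; simp add: X_def Y_def norm_pair_vec norm_mult power_mult_distrib)+
  have dist: "phase_dist (X p) (Y p) = sqrt 2" for p
  proof -
    obtain \<theta> \<phi> where p: "p = (\<theta>, \<phi>)" by (cases p)
    have "(cmod (of_real (cos (\<theta>/2))))\<^sup>2 + (cmod (cis \<phi> * of_real (sin (\<theta>/2))))\<^sup>2 = 1"
      by (simp add: norm_mult)
    from phase_dist_unitary_pair[OF ij this] show ?thesis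
      by (simp add: p X_def Y_def cis_cnj)
  qed
  have "\<exists>\<alpha> \<psi>. \<forall>p. (cmod ((B *v X p) $ k))\<^sup>2 = r k * (1 + zonal \<alpha> \<psi> p) / 2 \<and>
      (cmod ((B *v Y p) $ k))\<^sup>2 = r k * (1 - zonal \<alpha> \<psi> p) / 2" for k
  proof -
    obtain \<alpha> \<psi> where *:
      "\<And>\<theta> \<phi>. (cmod (B $ k $ i * of_real (cos (\<theta>/2)) + B $ k $ j * (cis \<phi> * of_real (sin (\<theta>/2)))))\<^sup>2 =
         r k * (1 + zonal \<alpha> \<psi> (\<theta>, \<phi>)) / 2"
      "\<And>\<theta> \<phi>. (cmod (B $ k $ j * of_real (cos (\<theta>/2)) - B $ k $ i * (cis (- \<phi>) * of_real (sin (\<theta>/2)))))\<^sup>2 =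
         r k * (1 - zonal \<alpha> \<psi> (\<theta>, \<phi>)) / 2"
      using complex_row_bloch[of "B $ k $ i" "B $ k $ j"] unfolding r_def by blast
    have "(B *v X (\<theta>, \<phi>)) $ k = B $ k $ i * of_real (cos (\<theta>/2)) + B $ k $ j * (cis \<phi> * of_real (sin (\<theta>/2)))"
      "(B *v Y (\<theta>, \<phi>)) $ k = B $ k $ j * of_real (cos (\<theta>/2)) - B $ k $ i * (cis (- \<phi>) * of_real (sin (\<theta>/2)))" for \<theta> \<phi>
      using ij by (simp_all add: X_def Y_def matrix_mult_pair_vec)
    then show ?thesis using * by (intro exI[of _ \<alpha>] exI[of _ \<psi>]) (simp only: split_paired_All simp_thms)
  qed
  then obtain \<alpha> \<psi> where
    AX: "\<And>k p. (cmod ((B *v X p) $ k))\<^sup>2 = r k * (1 + zonal (\<alpha> k) (\<psi> k) p) / 2" and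
    AY: "\<And>k p. (cmod ((B *v Y p) $ k))\<^sup>2 = r k * (1 - zonal (\<alpha> k) (\<psi> k) p) / 2"
    by metis
  have sq: "(cmod ((B *v X p) $ k))\<^sup>2 + (cmod ((B *v Y p) $ k))\<^sup>2 = r k" for k p
    unfolding AX AY by (simp add: field_simps)
  have "r k \<ge> 0" for k by (simp add: r_def)
  have prod: "cmod ((B *v X p) $ k) * cmod ((B *v Y p) $ k) = r k / 2 * sqrt (1 - (zonal (\<alpha> k) (\<psi> k) p)\<^sup>2)" for k p
  proof (rule power2_eq_imp_eq)
    have "\<bar>zonal (\<alpha> k) (\<psi> k) p\<bar> \<le> 1" using zonal_bounds[of "\<alpha> k" "\<psi> k" p] by (simp add: abs_le_iff)
    then have w: "(zonal (\<alpha> k) (\<psi> k) p)\<^sup>2 \<le> 1" by (simp add: abs_square_le_1)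
    then show "(cmod ((B *v X p) $ k) * cmod ((B *v Y p) $ k))\<^sup>2 =
        (r k / 2 * sqrt (1 - (zonal (\<alpha> k) (\<psi> k) p)\<^sup>2))\<^sup>2"
      by (simp add: power_mult_distrib AX AY) (simp add: power2_eq_square field_simps)
    show "0 \<le> r k / 2 * sqrt (1 - (zonal (\<alpha> k) (\<psi> k) p)\<^sup>2)" using w \<open>r k \<ge> 0\<close> by simp
  qed simp
  \<comment> \<open>The mean of \<open>sqrt (1 - w\<^sup>2)\<close> over the sphere is
    \<open>pi / 4\<close>, hence \<open>\<kappa> = 1 - pi / 4\<close>.\<close>
  have "ereal (sqrt (1 / ((4 - pi) / 4))) \<le> condition_number B"
  proof (rule condition_number_ge[OF _ unit(1) unit(2) dist])
    show "(4 - pi) / 4 > 0" using pi_less_4 by simp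
    show "(norm (B *v X 0))\<^sup>2 + (norm (B *v Y 0))\<^sup>2 = (\<Sum>k\<in>UNIV. r k)"
      by (simp add: norm_vec_squared sum.distrib[symmetric] sq)
    fix l
    assume l: "\<And>x y. phase_dist x y = sqrt 2 \<Longrightarrow>
      2 * l\<^sup>2 \<le> (norm (abs_vec (B *v x) - abs_vec (B *v y)))\<^sup>2"
    have le: "2 * l\<^sup>2 \<le> (\<Sum>k\<in>UNIV. r k * (1 - sqrt (1 - (zonal (\<alpha> k) (\<psi> k) p)\<^sup>2)))" for p
      using l[OF dist[of p]] by (simp add: norm_abs_vec_diff_squared sq prod algebra_simps)
    have sin_int: "((\<lambda>p. sin (fst p)) has_integral 4 * pi) ?D"
      unfolding has_integral_iff integral_sin_box
      by (auto intro!: integrable_continuous continuous_intros)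
    have zonal_int: "((\<lambda>p. sqrt (1 - (zonal (\<alpha> k) (\<psi> k) p)\<^sup>2) * sin (fst p)) has_integral pi\<^sup>2) ?D" for k
      unfolding has_integral_iff integral_sqrt_zonal
      by (auto intro!: integrable_continuous continuous_intros)
    have "((\<lambda>p. \<Sum>k\<in>UNIV. r k * (sin (fst p) - sqrt (1 - (zonal (\<alpha> k) (\<psi> k) p)\<^sup>2) * sin (fst p)))
        has_integral (\<Sum>k\<in>UNIV. r k * (4 * pi - pi\<^sup>2))) ?D"
      by (intro has_integral_sum has_integral_mult_right has_integral_diff sin_int zonal_int) auto
    moreover have "((\<lambda>p. 2 * l\<^sup>2 * sin (fst p)) has_integral 2 * l\<^sup>2 * (4 * pi)) ?D"
      by (intro has_integral_mult_right sin_int)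
    \<comment> \<open>The pointwise bound is multiplied by the area density
      \<open>sin (fst p)\<close>, nonnegative for polar angles in \<open>{0..pi}\<close>.\<close>
    moreover have "2 * l\<^sup>2 * sin (fst p) \<le>
        (\<Sum>k\<in>UNIV. r k * (sin (fst p) - sqrt (1 - (zonal (\<alpha> k) (\<psi> k) p)\<^sup>2) * sin (fst p)))" if "p \<in> ?D" for p
    proof -
      have "sin (fst p) \<ge> 0" using that by (cases p) (auto simp: cbox_Pair_eq intro: sin_ge_zero)
      from mult_right_mono[OF le[of p] this] show ?thesis
        by (simp only: sum_distrib_right) (simp add: algebra_simps)
    qed
    ultimately have "2 * l\<^sup>2 * (4 * pi) \<le> (\<Sum>k\<in>UNIV. r k * (4 * pi - pi\<^sup>2))"
      by (meson has_integral_le)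
    then have "pi * (2 * l\<^sup>2 * 4) \<le> pi * ((4 - pi) * (\<Sum>k\<in>UNIV. r k))"
      by (simp only: sum_distrib_right[symmetric]) (simp add: power2_eq_square algebra_simps)
    then show "2 * l\<^sup>2 \<le> (4 - pi) / 4 * (\<Sum>k\<in>UNIV. r k)"
      by simp
  qed
  then show ?thesis by simp
qed

theorem theorem2p2:
  fixes A :: "real^'d^'m" and B :: "complex^'d^'m"
  assumes "CARD('d) \<ge> 2"
  shows "condition_number A \<ge> ereal (sqrt (pi / (pi - 2))) \<and>
         condition_number B \<ge> ereal (sqrt (4 / (4 - pi)))"
proof -
  obtain i j :: 'd where "i \<noteq> j"
    using assms card_le_Suc0_iff_eq[of "UNIV :: 'd set"] by force
  then show ?thesis using condition_number_real condition_number_complex by blast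
qed

end
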